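(* Assume $A_n$ satisfies (C1) and the sparseness condition $$\liminf_{n\to\infty}\frac1n\sum_{i,j=1}^nA_n(i,j)^2>0.$$ Then for every $(\beta_0,B_0)\in\Theta$, under $\mathbb P_{n,\beta_0,B_0}$, with probability tending to one the pseudo-likelihood estimator $(\hat\beta_n,\hat B_n)$ exists and $\sqrt n(\hat\beta_n-\beta_0,\hat B_n-B_0)=O_p(1)$.
   Context: For each $n$, $A_n$ is a known symmetric $n\times n$ matrix with non-negative entries and zero diagonal. The Ising model is $\mathbb P_{n,\beta,B}(\mathbf X=\mathbf x)=Z_n(\beta,B)^{-1}\exp(\frac{\beta}{2}\mathbf x^\top A_n\mathbf x+B\sum_i x_i)$ on $\{-1,1\}^n$. (C1): there is a constant $\gamma<\infty$ with $\max_{i}\sum_{j}A_n(i,j)\le\gamma$ for all $n$. $\Theta=\{(\beta,B):\beta>0,B\ne0\}$. $m_i(\mathbf x)=\sum_jA_n(i,j)x_j$. The pseudo-likelihood estimator $(\hat\beta_n,\hat B_n)$ is the unique root in $\mathbb R^2$ of $\sum_i m_i(\mathbf x)(x_i-\tanh(\beta m_i(\mathbf x)+B))=0$, $\sum_i(x_i-\tanh(\beta m_i(\mathbf x)+B))=0$, when it exists. $U_n=O_p(1)$ means tight. *)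

theory Defs
  imports "HOL-Analysis.Analysis" "HOL-Library.FuncSet"
begin

text \<open>A sequence of interaction matrices: A n i j is the (i,j) entry of the n x n matrix A_n,
  with indices i, j ranging over {0..<n}.\<close>
type_synonym matseq = "nat \<Rightarrow> nat \<Rightarrow> nat \<Rightarrow> real"

definition configs :: "nat \<Rightarrow> (nat \<Rightarrow> real) set" where
  "configs n = {..<n} \<rightarrow>\<^sub>E {-1, 1}"

definition local_field :: "matseq \<Rightarrow> nat \<Rightarrow> (nat \<Rightarrow> real) \<Rightarrow> nat \<Rightarrow> real" where
  "local_field A n x i = (\<Sum>j<n. A n i j * x j)"

definition ising_weight :: "matseq \<Rightarrow> nat \<Rightarrow> real \<Rightarrow> real \<Rightarrow> (nat \<Rightarrow> real) \<Rightarrow> real" where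
  "ising_weight A n \<beta> B x =
     exp (\<beta> / 2 * (\<Sum>i<n. \<Sum>j<n. x i * A n i j * x j) + B * (\<Sum>i<n. x i))"

definition partition_fn :: "matseq \<Rightarrow> nat \<Rightarrow> real \<Rightarrow> real \<Rightarrow> real" where
  "partition_fn A n \<beta> B = (\<Sum>x\<in>configs n. ising_weight A n \<beta> B x)"

definition ising_prob :: "matseq \<Rightarrow> nat \<Rightarrow> real \<Rightarrow> real \<Rightarrow> ((nat \<Rightarrow> real) \<Rightarrow> bool) \<Rightarrow> real" where
  "ising_prob A n \<beta> B S =
     (\<Sum>x\<in>{x\<in>configs n. S x}. ising_weight A n \<beta> B x) / partition_fn A n \<beta> B"

definition pl_eqs :: "matseq \<Rightarrow> nat \<Rightarrow> (nat \<Rightarrow> real) \<Rightarrow> real \<times> real \<Rightarrow> bool" where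
  "pl_eqs A n x p =
     ((\<Sum>i<n. local_field A n x i * (x i - tanh (fst p * local_field A n x i + snd p))) = 0 \<and>
      (\<Sum>i<n. x i - tanh (fst p * local_field A n x i + snd p)) = 0)"

definition pl_exists :: "matseq \<Rightarrow> nat \<Rightarrow> (nat \<Rightarrow> real) \<Rightarrow> bool" where
  "pl_exists A n x = (\<exists>!p. pl_eqs A n x p)"

definition pl_est :: "matseq \<Rightarrow> nat \<Rightarrow> (nat \<Rightarrow> real) \<Rightarrow> real \<times> real" where
  "pl_est A n x = (THE p. pl_eqs A n x p)"

end

theory Submission
  imports Defs
begin

text \<open>Let \<open>t\<^sub>j = tanh (\<beta> m\<^sub>j + B)\<close> be the conditional mean of \<open>x\<^sub>j\<close> given the other spins. A sum
  \<open>V = \<Sum>\<^sub>j h\<^sub>j (x\<^sub>j - t\<^sub>j)\<close> in which \<open>h\<^sub>j\<close> is bounded and independent of \<open>x\<^sub>j\<close>, and which changes by \<open>O(1)\<close>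
  when a spin is flipped, has second moment \<open>O(n)\<close>. This bounds the pseudo-score at the true parameter
  by \<open>O(\<surd>n)\<close>, and it also controls the vector \<open>v\<^sub>i = \<Sum>\<^sub>j A\<^sub>i\<^sub>j (x\<^sub>j - t\<^sub>j)\<close>: up to \<open>O(\<surd>n)\<close>,
  \<open>\<Sum>\<^sub>i v\<^sub>i\<close> vanishes and \<open>\<Sum>\<^sub>i m\<^sub>i v\<^sub>i\<close> is at least a multiple of \<open>\<Sum>\<^sub>i\<^sub>j A\<^sub>i\<^sub>j\<^sup>2\<close>, hence of \<open>n\<close>. Testing
  \<open>a m\<^sub>i + b\<close> against \<open>v\<close> with Cauchy-Schwarz shows that the local fields are not nearly constant,
  \<open>\<Sum>\<^sub>i (a m\<^sub>i + b)\<^sup>2 \<ge> \<lambda> n (a\<^sup>2 + b\<^sup>2)\<close>, with high probability. The pseudo-score is therefore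
  strongly decreasing near the true parameter, so it points inwards on a sphere of radius of order
  \<open>1/\<surd>n\<close>, and Brouwer's theorem gives a zero inside; strict monotonicity gives uniqueness.\<close>

subsection \<open>Analytic preliminaries\<close>

text \<open>Brouwer's theorem applied to \<open>x + f x\<close> projected back onto the ball: at a
  fixed point, \<open>f x\<close> lies in the normal cone of the ball. On the sphere this
  contradicts the inward condition, tested at the centre; in the interior the normal cone is
  zero.\<close>

lemma zero_in_cball:
  fixes f :: "'a::euclidean_space \<Rightarrow> 'a"
  assumes cont: "continuous_on (cball a r) f" and "r > 0"
    and inward: "\<And>x. dist a x = r \<Longrightarrow> f x \<bullet> (x - a) < 0"
  shows "\<exists>x\<in>cball a r. f x = 0"
proof -
  let ?g = "\<lambda>x. closest_point (cball a r) (x + f x)"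
  have ne: "cball a r \<noteq> {}" using \<open>r > 0\<close> by auto
  have "continuous_on (cball a r) ?g"
    by (rule continuous_on_compose2[OF continuous_on_closest_point[OF convex_cball closed_cball ne]])
      (auto intro!: continuous_intros cont)
  moreover have "?g \<in> cball a r \<rightarrow> cball a r"
    using closest_point_in_set[OF closed_cball ne] by blast
  ultimately obtain x where x: "x \<in> cball a r" "?g x = x"
    using brouwer[OF compact_cball convex_cball ne] by blast
  have normal: "f x \<bullet> (y - x) \<le> 0" if "y \<in> cball a r" for y
    using closest_point_dot[OF convex_cball closed_cball that, of "x + f x"] x(2) by simp
  have "dist a x \<noteq> r"
    using inward[of x] normal[of a] \<open>r > 0\<close> by (auto simp: inner_diff_right)
  then have "x \<in> ball a r" using x(1) by auto
  then obtain e where e: "e > 0" "cball x e \<subseteq> ball a r"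
    using open_contains_cball[of "ball a r"] open_ball by blast
  have "f x = 0"
  proof (rule ccontr)
    assume "f x \<noteq> 0"
    \<comment> \<open>A step of length \<open>e\<close> in the direction of \<open>f x\<close> stays
      in the ball, so the normal-cone inequality can be tested on \<open>f x\<close> itself.\<close>
    define y where "y = x + (e / norm (f x)) *\<^sub>R f x"
    have "y \<in> cball x e" using e(1) \<open>f x \<noteq> 0\<close> by (simp add: y_def dist_norm)
    then have "f x \<bullet> (y - x) \<le> 0" using e(2) by (intro normal) auto
    then have "f x \<bullet> f x \<le> 0"
      using e(1) \<open>f x \<noteq> 0\<close> by (simp add: y_def field_simps mult_le_0_iff)
    then show False using \<open>f x \<noteq> 0\<close> inner_gt_zero_iff not_le by blast
  qed
  then show ?thesis using x(1) by blast
qed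

lemma tanh_lipschitz: "\<bar>tanh a - tanh b\<bar> \<le> \<bar>a - b\<bar>" for a b :: real
proof -
  have "norm (tanh a - tanh b) \<le> 1 * norm (a - b)"
  proof (rule field_differentiable_bound[of UNIV _ "\<lambda>x. 1 - tanh x ^ 2"])
    show "(tanh has_field_derivative 1 - (tanh x)\<^sup>2) (at x within UNIV)" for x :: real
      by (rule derivative_eq_intros refl | simp)+
    show "norm (1 - (tanh x)\<^sup>2) \<le> 1" for x :: real
      using tanh_real_bounds[of x] by (simp add: abs_square_le_1 abs_le_iff)
  qed auto
  then show ?thesis by simp
qed

text \<open>Mean value theorem: the derivative \<open>1 - tanh z ^ 2\<close> is smallest at the ends
  of the interval from \<open>- R\<close> to \<open>R\<close>. This strong monotonicity drives both
  existence and uniqueness of the root.\<close>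

lemma tanh_coercive:
  fixes a b :: real
  assumes "\<bar>a\<bar> \<le> R" "\<bar>b\<bar> \<le> R"
  shows "(1 - tanh R ^ 2) * (a - b)\<^sup>2 \<le> (tanh a - tanh b) * (a - b)"
proof -
  have *: "(1 - tanh R ^ 2) * (a - b)\<^sup>2 \<le> (tanh a - tanh b) * (a - b)"
    if ab: "\<bar>a\<bar> \<le> R" "\<bar>b\<bar> \<le> R" "b < a" for a b :: real
  proof -
    have "\<exists>z. b < z \<and> z < a \<and> tanh a - tanh b = (a - b) * (1 - tanh z ^ 2)"
      by (rule MVT2[OF ab(3)]) (rule derivative_eq_intros refl | simp)+
    then obtain z where z: "b < z" "z < a" "tanh a - tanh b = (a - b) * (1 - tanh z ^ 2)" by blast
    have "tanh \<bar>z\<bar> \<le> tanh R" using ab z unfolding tanh_real_le_iff by linarith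
    then have "tanh z ^ 2 \<le> tanh R ^ 2" by (intro abs_le_square_iff[THEN iffD1]) simp
    then have "(1 - tanh R ^ 2) * (a - b)\<^sup>2 \<le> (1 - tanh z ^ 2) * (a - b)\<^sup>2"
      by (intro mult_right_mono) auto
    then show ?thesis using z(3) by (simp add: power2_eq_square mult_ac)
  qed
  show ?thesis
  proof (cases a b rule: linorder_cases)
    case less
    then show ?thesis using *[of b a] assms by (simp add: power2_eq_square algebra_simps)
  qed (use * assms in auto)
qed

text \<open>\<open>exp (- 2 * s * y)\<close> is the weight of spin \<open>- s\<close> relative to
  spin \<open>s\<close> in a field \<open>y\<close>; a spin with this two-point law has mean
  \<open>tanh y\<close>.\<close>

lemma tilt_balance:
  assumes "s = - 1 \<or> s = (1::real)"
  shows "(s - tanh y) + exp (- 2 * s * y) * (- s - tanh y) = 0"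
proof -
  have "1 + exp (- 2 * y) > 0" "1 + exp (2 * y) > 0" by (intro add_pos_pos; simp)+
  moreover have "tanh y = (1 - exp (- 2 * y)) / (1 + exp (- 2 * y))" by (rule tanh_real_altdef)
  moreover have "- tanh y = (1 - exp (2 * y)) / (1 + exp (2 * y))"
    using tanh_real_altdef[of "- y"] by simp
  ultimately show ?thesis using assms by (auto simp: field_simps)
qed

text \<open>Testing \<open>a * m i + b\<close> against \<open>v\<close> bounds
  \<open>\<bar>a\<bar>\<close> by a multiple of its root mean square plus a multiple of
  \<open>\<bar>b\<bar>\<close>; testing against 1 bounds \<open>\<bar>b\<bar>\<close> by the root
  mean square plus \<open>\<bar>a\<bar> * \<gamma>\<close>. Solving the two inequalities bounds both
  coefficients.\<close>

lemma design_bound: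
  fixes m v :: "nat \<Rightarrow> real"
  assumes "n > 0" and \<gamma>: "\<gamma> > 0" and "c > 0"
    and m: "\<And>i. i < n \<Longrightarrow> \<bar>m i\<bar> \<le> \<gamma>"
    and v: "\<And>i. i < n \<Longrightarrow> \<bar>v i\<bar> \<le> 2 * \<gamma>"
    and Z: "(\<Sum>i<n. m i * v i) \<ge> c * n"
    and D: "\<bar>\<Sum>i<n. v i\<bar> \<le> c / (2 * \<gamma>) * n"
  defines "\<mu> \<equiv> 4 * \<gamma> / c + 1 / \<gamma>"
  shows "n * (a\<^sup>2 + b\<^sup>2) \<le> (\<mu>\<^sup>2 + (1 + \<mu> * \<gamma>)\<^sup>2) * (\<Sum>i<n. (a * m i + b)\<^sup>2)"
proof -
  define y where "y i = a * m i + b" for i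
  define s where "s = sqrt ((\<Sum>i<n. (y i)\<^sup>2) / n)"
  have s0: "s \<ge> 0" and s2: "n * s\<^sup>2 = (\<Sum>i<n. (y i)\<^sup>2)"
    using \<open>n > 0\<close> by (auto simp: s_def sum_nonneg)
  have cs: "\<bar>\<Sum>i<n. y i * u i\<bar> \<le> C * n * s" if u: "\<And>i. i < n \<Longrightarrow> \<bar>u i\<bar> \<le> C" and "C \<ge> 0" for u C
  proof -
    have "(\<Sum>i<n. y i * u i)\<^sup>2 \<le> (\<Sum>i<n. (y i)\<^sup>2) * (\<Sum>i<n. (u i)\<^sup>2)"
      by (rule Cauchy_Schwarz_ineq_sum)
    also have "\<dots> \<le> (\<Sum>i<n. (y i)\<^sup>2) * (\<Sum>i<n. C\<^sup>2)"
    proof (intro mult_left_mono sum_mono)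
      show "(u i)\<^sup>2 \<le> C\<^sup>2" if "i \<in> {..<n}" for i
        using u[of i] that \<open>C \<ge> 0\<close> by (intro abs_le_square_iff[THEN iffD1]) simp
    qed (simp add: sum_nonneg)
    also have "\<dots> = (C * n * s)\<^sup>2"
      by (simp add: s2[symmetric] power_mult_distrib) (simp add: power2_eq_square)
    finally have "\<bar>\<Sum>i<n. y i * u i\<bar> \<le> \<bar>C * n * s\<bar>"
      by (simp only: abs_le_square_iff)
    also have "\<bar>C * n * s\<bar> = C * n * s"
      using s0 \<open>C \<ge> 0\<close> by (intro abs_of_nonneg) simp
    finally show ?thesis .
  qed
  have "\<bar>a\<bar> * (c * n) \<le> \<bar>a * (\<Sum>i<n. m i * v i)\<bar>"
    using Z unfolding abs_mult by (intro mult_left_mono) auto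
  also have "a * (\<Sum>i<n. m i * v i) = (\<Sum>i<n. y i * v i) - b * (\<Sum>i<n. v i)"
    by (simp add: y_def sum_distrib_left sum_subtractf[symmetric] algebra_simps)
  also have "\<bar>\<dots>\<bar> \<le> \<bar>\<Sum>i<n. y i * v i\<bar> + \<bar>b * (\<Sum>i<n. v i)\<bar>"
    by (rule abs_triangle_ineq4)
  also have "\<dots> \<le> 2 * \<gamma> * n * s + \<bar>b\<bar> * (c / (2 * \<gamma>) * n)"
    using cs[of v "2 * \<gamma>"] v \<gamma> D unfolding abs_mult by (intro add_mono mult_left_mono) auto
  finally have "(\<bar>a\<bar> * c) * n \<le> (2 * \<gamma> * s + \<bar>b\<bar> * (c / (2 * \<gamma>))) * n"
    by (simp add: algebra_simps)
  then have 1: "\<bar>a\<bar> * c \<le> 2 * \<gamma> * s + \<bar>b\<bar> * (c / (2 * \<gamma>))"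
    by (rule mult_right_le_imp_le) (use \<open>n > 0\<close> in simp)
  have "b * n = (\<Sum>i<n. y i * 1) - a * (\<Sum>i<n. m i)"
    by (simp add: y_def sum_distrib_left sum.distrib)
  moreover have "\<bar>\<Sum>i<n. m i\<bar> \<le> \<gamma> * n"
    using sum_norm_le[of "{..<n}" m "\<lambda>_. \<gamma>"] m by (simp add: mult.commute)
  then have "\<bar>a * (\<Sum>i<n. m i)\<bar> \<le> \<bar>a\<bar> * (\<gamma> * n)"
    unfolding abs_mult by (intro mult_left_mono) auto
  ultimately have "\<bar>b * n\<bar> \<le> (s + \<bar>a\<bar> * \<gamma>) * n"
    using cs[of "\<lambda>_. 1" 1] by (simp add: algebra_simps)
  then have 2: "\<bar>b\<bar> \<le> s + \<bar>a\<bar> * \<gamma>" using \<open>n > 0\<close> by (simp add: abs_mult)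
  \<comment> \<open>The factor \<open>c / (2 * \<gamma>)\<close> in \<open>D\<close> is chosen so
    that inserting 2 into 1 costs \<open>\<bar>a\<bar> * c / 2\<close>, half of the left-hand side,
    which can be absorbed.\<close>
  have "\<bar>b\<bar> * (c / (2 * \<gamma>)) \<le> (s + \<bar>a\<bar> * \<gamma>) * (c / (2 * \<gamma>))"
    using 2 \<gamma> \<open>c > 0\<close> by (intro mult_right_mono) auto
  then have "\<bar>a\<bar> * c / 2 \<le> 2 * \<gamma> * s + s * (c / (2 * \<gamma>))"
    using 1 \<gamma> by (simp add: field_simps)
  then have a: "\<bar>a\<bar> \<le> \<mu> * s"
    using \<gamma> \<open>c > 0\<close> by (simp add: \<mu>_def field_simps)
  have "\<bar>b\<bar> \<le> (1 + \<mu> * \<gamma>) * s"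
    using 2 mult_right_mono[OF a less_imp_le[OF \<gamma>]] by (simp add: algebra_simps)
  moreover have sq: "p\<^sup>2 \<le> q\<^sup>2" if "\<bar>p\<bar> \<le> q" for p q :: real
    using that by (intro abs_le_square_iff[THEN iffD1]) simp
  ultimately have "a\<^sup>2 \<le> (\<mu> * s)\<^sup>2" "b\<^sup>2 \<le> ((1 + \<mu> * \<gamma>) * s)\<^sup>2"
    using a by blast+
  then have "a\<^sup>2 + b\<^sup>2 \<le> (\<mu>\<^sup>2 + (1 + \<mu> * \<gamma>)\<^sup>2) * s\<^sup>2"
    unfolding power_mult_distrib distrib_right[of _ _ "s\<^sup>2"] by (rule add_mono)
  then have "n * (a\<^sup>2 + b\<^sup>2) \<le> n * ((\<mu>\<^sup>2 + (1 + \<mu> * \<gamma>)\<^sup>2) * s\<^sup>2)"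
    by (intro mult_left_mono) auto
  also have "\<dots> = (\<mu>\<^sup>2 + (1 + \<mu> * \<gamma>)\<^sup>2) * (n * s\<^sup>2)" by simp
  finally show ?thesis unfolding s2 y_def .
qed

subsection \<open>Roots of the pseudo-score\<close>

text \<open>The gradient in \<open>p\<close> of the log-pseudo-likelihood, the sum of the
  conditional log-probabilities of each spin given the others. It is taken as a map of the plane so
  that \<open>zero_in_cball\<close> applies.\<close>

definition pl_score :: "matseq \<Rightarrow> nat \<Rightarrow> (nat \<Rightarrow> real) \<Rightarrow> real \<times> real \<Rightarrow> real \<times> real" where
  "pl_score A n x p =
     ((\<Sum>i<n. local_field A n x i * (x i - tanh (fst p * local_field A n x i + snd p))),
      (\<Sum>i<n. x i - tanh (fst p * local_field A n x i + snd p)))"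

lemma pl_eqs_iff: "pl_eqs A n x p \<longleftrightarrow> pl_score A n x p = 0"
  by (simp add: pl_eqs_def pl_score_def zero_prod_def)

lemma continuous_on_pl_score: "continuous_on S (pl_score A n x)"
  unfolding pl_score_def by (intro continuous_intros) auto

text \<open>Paired with \<open>p - q\<close>, the difference of scores is minus a sum of
  \<open>tanh\<close> increments times the increments of their arguments, so
  \<open>tanh_coercive\<close> applies term by term.\<close>

lemma pl_score_coercive:
  assumes "\<And>i. i < n \<Longrightarrow> \<bar>fst p * local_field A n x i + snd p\<bar> \<le> R"
    and "\<And>i. i < n \<Longrightarrow> \<bar>fst q * local_field A n x i + snd q\<bar> \<le> R"
  shows "(pl_score A n x p - pl_score A n x q) \<bullet> (p - q)
           \<le> - (1 - tanh R ^ 2) * (\<Sum>i<n. (fst (p - q) * local_field A n x i + snd (p - q))\<^sup>2)"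
proof -
  let ?y = "\<lambda>p i. fst p * local_field A n x i + snd p"
  let ?D = "\<lambda>i. tanh (?y p i) - tanh (?y q i)"
  have "pl_score A n x p - pl_score A n x q = (- (\<Sum>i<n. local_field A n x i * ?D i), - (\<Sum>i<n. ?D i))"
    by (simp add: pl_score_def sum_subtractf[symmetric] sum_negf[symmetric] right_diff_distrib)
  then have "(pl_score A n x p - pl_score A n x q) \<bullet> (p - q)
      = - (\<Sum>i<n. fst (p - q) * (local_field A n x i * ?D i) + snd (p - q) * ?D i)"
    by (simp add: inner_prod_def sum.distrib sum_distrib_left[symmetric] mult.commute)
  also have "\<dots> = - (\<Sum>i<n. ?D i * (?y p i - ?y q i))"
    by (simp add: algebra_simps)
  also have "\<dots> \<le> - (\<Sum>i<n. (1 - tanh R ^ 2) * (?y p i - ?y q i)\<^sup>2)"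
    using assms by (intro le_imp_neg_le sum_mono tanh_coercive) auto
  also have "\<dots> = - (1 - tanh R ^ 2) * (\<Sum>i<n. (?y p i - ?y q i)\<^sup>2)"
    by (simp only: sum_distrib_left[symmetric] mult_minus_left)
  also have "\<dots> = - (1 - tanh R ^ 2) * (\<Sum>i<n. (?y (p - q) i)\<^sup>2)"
    by (simp add: algebra_simps)
  finally show ?thesis .
qed

lemma tanh_sq_less_1: "tanh x ^ 2 < 1" for x :: real
  using tanh_real_bounds[of x] by (simp add: abs_square_less_1 abs_less_iff)

text \<open>The deterministic core. On the sphere of radius \<open>M / sqrt n\<close> about the true
  parameter, coercivity outweighs the score at the centre, which gives a root inside; coercivity
  between two roots forces them to coincide.\<close>

lemma pl_est_close:
  fixes A :: matseq and x :: "nat \<Rightarrow> real"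
  assumes "n > 0" "\<gamma> \<ge> 0" "\<Lambda> > 0" "K > 0"
    and m: "\<And>i. i < n \<Longrightarrow> \<bar>local_field A n x i\<bar> \<le> \<gamma>"
    and design: "\<And>a b. n * (a\<^sup>2 + b\<^sup>2) \<le> \<Lambda> * (\<Sum>i<n. (a * local_field A n x i + b)\<^sup>2)"
    and score: "\<bar>fst (pl_score A n x (\<beta>, B))\<bar> \<le> K * sqrt n" "\<bar>snd (pl_score A n x (\<beta>, B))\<bar> \<le> K * sqrt n"
  defines "M \<equiv> 4 * K * \<Lambda> / (1 - tanh (\<bar>\<beta>\<bar> * \<gamma> + \<bar>B\<bar> + \<gamma> + 1) ^ 2)"
  assumes "M \<le> sqrt n"
  shows "pl_exists A n x \<and> sqrt n * \<bar>fst (pl_est A n x) - \<beta>\<bar> \<le> M \<and> sqrt n * \<bar>snd (pl_est A n x) - B\<bar> \<le> M"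
proof -
  let ?F = "pl_score A n x" and ?m = "local_field A n x"
  \<comment> \<open>Bounds the arguments of \<open>tanh\<close> at all parameters within distance 1
    of \<open>(\<beta>, B)\<close>; the assumption \<open>M \<le> sqrt n\<close> keeps the radius at
    most 1.\<close>
  define R where "R = \<bar>\<beta>\<bar> * \<gamma> + \<bar>B\<bar> + \<gamma> + 1"
  define \<kappa> where "\<kappa> = 1 - tanh R ^ 2"
  define r where "r = M / sqrt n"
  have \<kappa>: "\<kappa> > 0" using tanh_sq_less_1 by (simp add: \<kappa>_def)
  have M: "M = 4 * K * \<Lambda> / \<kappa>" by (simp add: M_def \<kappa>_def R_def)
  then have "M > 0" using \<kappa> \<open>K > 0\<close> \<open>\<Lambda> > 0\<close> by simp
  then have r: "r > 0" "r \<le> 1" using \<open>n > 0\<close> \<open>M \<le> sqrt n\<close> by (auto simp: r_def)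
  have lin: "\<bar>fst p * ?m i + snd p\<bar> \<le> \<bar>fst p\<bar> * \<gamma> + \<bar>snd p\<bar>" if "i < n" for p i
    using mult_left_mono[OF m[OF that], of "\<bar>fst p\<bar>"] abs_triangle_ineq[of "fst p * ?m i" "snd p"]
    by (simp add: abs_mult)
  have design': "n * (norm p)\<^sup>2 \<le> \<Lambda> * (\<Sum>i<n. (fst p * ?m i + snd p)\<^sup>2)" for p
    using design[of "fst p" "snd p"] by (simp add: norm_prod_def)
  have comp: "\<bar>fst p\<bar> \<le> norm p" "\<bar>snd p\<bar> \<le> norm p" for p :: "real \<times> real"
    using norm_fst_le[of "fst p" "snd p"] norm_snd_le[of "snd p" "fst p"] by auto
  have "\<exists>p\<in>cball (\<beta>, B) r. ?F p = 0"
  proof (rule zero_in_cball[OF continuous_on_pl_score r(1)])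
    fix p assume p: "dist (\<beta>, B) p = r"
    define d where "d = p - (\<beta>, B)"
    have d: "norm d = r" using p by (simp add: d_def dist_norm norm_minus_commute)
    have "\<bar>fst p\<bar> \<le> \<bar>\<beta>\<bar> + r" "\<bar>snd p\<bar> \<le> \<bar>B\<bar> + r"
      using comp[of d] unfolding d by (auto simp: d_def)
    then have "\<bar>fst p\<bar> * \<gamma> + \<bar>snd p\<bar> \<le> (\<bar>\<beta>\<bar> + r) * \<gamma> + (\<bar>B\<bar> + r)"
      using \<open>\<gamma> \<ge> 0\<close> by (intro add_mono mult_right_mono) auto
    also have "\<dots> \<le> R"
      using mult_right_mono[OF r(2) \<open>\<gamma> \<ge> 0\<close>] r(2) by (simp add: R_def algebra_simps)
    finally have pR: "\<bar>fst p * ?m i + snd p\<bar> \<le> R" if "i < n" for i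
      using lin[OF that, of p] by linarith
    have qR: "\<bar>fst (\<beta>, B) * ?m i + snd (\<beta>, B)\<bar> \<le> R" if "i < n" for i
      using lin[OF that, of "(\<beta>, B)"] \<open>\<gamma> \<ge> 0\<close> by (simp add: R_def)
    have "(?F p - ?F (\<beta>, B)) \<bullet> d \<le> - \<kappa> * (\<Sum>i<n. (fst d * ?m i + snd d)\<^sup>2)"
      unfolding d_def \<kappa>_def by (rule pl_score_coercive[OF pR qR])
    also have "\<dots> \<le> - \<kappa> * (n * r\<^sup>2 / \<Lambda>)"
      using design'[of d] \<kappa> \<open>\<Lambda> > 0\<close> by (simp add: d field_simps)
    finally have 1: "?F p \<bullet> d \<le> ?F (\<beta>, B) \<bullet> d - \<kappa> * (n * r\<^sup>2 / \<Lambda>)"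
      by (simp add: inner_diff_left)
    have "?F (\<beta>, B) \<bullet> d \<le> norm (?F (\<beta>, B)) * r"
      using norm_cauchy_schwarz[of "?F (\<beta>, B)" d] d by simp
    also have "norm (?F (\<beta>, B)) \<le> \<bar>fst (?F (\<beta>, B))\<bar> + \<bar>snd (?F (\<beta>, B))\<bar>"
      using norm_Pair_le[of "fst (?F (\<beta>, B))" "snd (?F (\<beta>, B))"] by simp
    then have "norm (?F (\<beta>, B)) * r \<le> 2 * K * sqrt n * r"
      using score r(1) by (intro mult_right_mono) auto
    finally have 2: "?F p \<bullet> d \<le> 2 * K * sqrt n * r - \<kappa> * (n * r\<^sup>2 / \<Lambda>)"
      using 1 by linarith
    \<comment> \<open>The choice of \<open>M\<close> balances the terms: on the sphere the score at
      the centre contributes at most \<open>2 * K * M\<close>, while coercivity removes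
      \<open>4 * K * M\<close>.\<close>
    have "sqrt n * r = M" using \<open>n > 0\<close> by (simp add: r_def)
    then have "n * r\<^sup>2 = M\<^sup>2" by (metis power_mult_distrib real_sqrt_pow2 of_nat_0_le_iff)
    then have "\<kappa> * (n * r\<^sup>2 / \<Lambda>) = 4 * K * M"
      using \<kappa> \<open>\<Lambda> > 0\<close> by (simp add: M power2_eq_square)
    moreover have "2 * K * sqrt n * r = 2 * K * M" using \<open>sqrt n * r = M\<close> by simp
    moreover have "0 < K * M" using \<open>K > 0\<close> \<open>M > 0\<close> by simp
    ultimately show "?F p \<bullet> (p - (\<beta>, B)) < 0" using 2 unfolding d_def by linarith
  qed
  then obtain p where p: "dist (\<beta>, B) p \<le> r" "?F p = 0" by auto
  have uniq: "q = p" if "?F q = 0" for q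
  proof -
    \<comment> \<open>The bound depends on the two roots, but only positivity of
      \<open>1 - tanh R' ^ 2\<close> is used, so uniqueness holds in the whole plane.\<close>
    define R' where "R' = max (\<bar>fst q\<bar> * \<gamma> + \<bar>snd q\<bar>) (\<bar>fst p\<bar> * \<gamma> + \<bar>snd p\<bar>)"
    have "\<bar>fst q * ?m i + snd q\<bar> \<le> R'" "\<bar>fst p * ?m i + snd p\<bar> \<le> R'" if "i < n" for i
      using lin[OF that, of p] lin[OF that, of q] by (auto simp: R'_def le_max_iff_disj)
    then have "(?F q - ?F p) \<bullet> (q - p)
        \<le> - (1 - tanh R' ^ 2) * (\<Sum>i<n. (fst (q - p) * ?m i + snd (q - p))\<^sup>2)"
      by (rule pl_score_coercive)
    then have "(\<Sum>i<n. (fst (q - p) * ?m i + snd (q - p))\<^sup>2) \<le> 0"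
      using p(2) that tanh_sq_less_1[of R'] by (simp add: zero_le_mult_iff)
    then have "n * (norm (q - p))\<^sup>2 \<le> 0"
      using design'[of "q - p"] \<open>\<Lambda> > 0\<close> by (meson mult_le_0_iff order_trans less_imp_le)
    then show ?thesis using \<open>n > 0\<close> by (simp add: mult_le_0_iff)
  qed
  have "pl_exists A n x" unfolding pl_exists_def pl_eqs_iff using p(2) uniq by blast
  moreover have "pl_est A n x = p" unfolding pl_est_def pl_eqs_iff using p(2) uniq by (rule the_equality)
  moreover have "\<bar>fst p - \<beta>\<bar> \<le> r" "\<bar>snd p - B\<bar> \<le> r"
    using comp[of "p - (\<beta>, B)"] p(1) by (auto simp: dist_norm norm_minus_commute)
  ultimately show ?thesis using \<open>n > 0\<close> by (simp add: r_def field_simps)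
qed

subsection \<open>Sums of conditionally centred spins\<close>

definition flip :: "nat \<Rightarrow> (nat \<Rightarrow> real) \<Rightarrow> nat \<Rightarrow> real" where
  "flip j x = x(j := - x j)"

lemma flip_same [simp]: "flip j x j = - x j"
  and flip_other [simp]: "k \<noteq> j \<Longrightarrow> flip j x k = x k"
  and flip_flip [simp]: "flip j (flip j x) = x"
  by (auto simp: flip_def)

lemma finite_configs [simp]: "finite (configs n)"
  unfolding configs_def by (intro finite_PiE) auto

lemma configs_nonempty: "configs n \<noteq> {}"
  unfolding configs_def by (simp add: PiE_eq_empty_iff)

lemma config_values: "x \<in> configs n \<Longrightarrow> i < n \<Longrightarrow> x i = - 1 \<or> x i = 1"
  unfolding configs_def by auto

lemma abs_config: "x \<in> configs n \<Longrightarrow> i < n \<Longrightarrow> \<bar>x i\<bar> = 1"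
  using config_values[of x n i] by auto

lemma flip_configs: "x \<in> configs n \<Longrightarrow> j < n \<Longrightarrow> flip j x \<in> configs n"
  using config_values[of x n j] unfolding configs_def flip_def PiE_iff extensional_def by auto

lemma sum_flip:
  assumes "j < n"
  shows "(\<Sum>x\<in>configs n. f (flip j x)) = (\<Sum>x\<in>configs n. f x)"
  by (rule sum.reindex_bij_witness[of _ "flip j" "flip j"]) (simp_all add: assms flip_configs)

lemma ising_weight_pos: "ising_weight A n \<beta> B x > 0"
  by (simp add: ising_weight_def)

lemma partition_fn_pos: "partition_fn A n \<beta> B > 0"
  unfolding partition_fn_def using configs_nonempty by (intro sum_pos) (auto simp: ising_weight_pos)

section \<open>The Ising measure of fixed size\<close>

locale ising =
  fixes A :: matseq and n :: nat and \<beta> B \<gamma> :: real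
  assumes symm: "i < n \<Longrightarrow> j < n \<Longrightarrow> A n i j = A n j i"
    and nonneg: "i < n \<Longrightarrow> j < n \<Longrightarrow> A n i j \<ge> 0"
    and diag: "i < n \<Longrightarrow> A n i i = 0"
    and row_sum: "i < n \<Longrightarrow> (\<Sum>j<n. A n i j) \<le> \<gamma>"
    and \<gamma>_nonneg: "\<gamma> \<ge> 0"
begin

abbreviation m :: "(nat \<Rightarrow> real) \<Rightarrow> nat \<Rightarrow> real" where "m \<equiv> local_field A n"

definition t :: "(nat \<Rightarrow> real) \<Rightarrow> nat \<Rightarrow> real" where "t x j = tanh (\<beta> * m x j + B)"

definition expect :: "((nat \<Rightarrow> real) \<Rightarrow> real) \<Rightarrow> real" where
  "expect f = (\<Sum>x\<in>configs n. ising_weight A n \<beta> B x * f x) / partition_fn A n \<beta> B"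

lemma expect_add: "expect (\<lambda>x. f x + g x) = expect f + expect g"
  by (simp add: expect_def sum.distrib add_divide_distrib distrib_left)

lemma expect_cmult: "expect (\<lambda>x. c * f x) = c * expect f"
  by (simp add: expect_def sum_distrib_left mult_ac)

lemma expect_sum: "expect (\<lambda>x. \<Sum>i\<in>I. f i x) = (\<Sum>i\<in>I. expect (f i))"
  unfolding expect_def sum_divide_distrib[symmetric] sum_distrib_left by (subst sum.swap) simp

lemma expect_const: "expect (\<lambda>_. c) = c"
  using partition_fn_pos[of A n \<beta> B]
  by (simp add: expect_def sum_distrib_right[symmetric]) (simp add: partition_fn_def)

lemma expect_cong: "(\<And>x. x \<in> configs n \<Longrightarrow> f x = g x) \<Longrightarrow> expect f = expect g"
  by (simp add: expect_def)

lemma expect_mono: "(\<And>x. x \<in> configs n \<Longrightarrow> f x \<le> g x) \<Longrightarrow> expect f \<le> expect g"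
  unfolding expect_def
  by (intro divide_right_mono sum_mono mult_left_mono)
    (auto simp: ising_weight_pos partition_fn_pos less_imp_le)

lemma ising_prob_eq_expect: "ising_prob A n \<beta> B S = expect (\<lambda>x. of_bool (S x))"
proof -
  have "(\<Sum>x\<in>{x\<in>configs n. S x}. ising_weight A n \<beta> B x)
      = (\<Sum>x\<in>configs n. ising_weight A n \<beta> B x * of_bool (S x))"
    by (intro sum.mono_neutral_cong_left) auto
  then show ?thesis by (simp add: ising_prob_def expect_def)
qed

section \<open>Local fields and single-spin flips\<close>

lemma col_sum: "j < n \<Longrightarrow> (\<Sum>i<n. A n i j) \<le> \<gamma>"
  using row_sum[of j] symm[of j] by simp

lemma local_field_bound:
  assumes "x \<in> configs n" "i < n"
  shows "\<bar>m x i\<bar> \<le> \<gamma>"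
proof -
  have "\<bar>m x i\<bar> \<le> (\<Sum>j<n. \<bar>A n i j * x j\<bar>)" unfolding local_field_def by (rule sum_abs)
  also have "\<dots> = (\<Sum>j<n. A n i j)"
    using assms abs_config nonneg by (intro sum.cong) (auto simp: abs_mult)
  finally show ?thesis using row_sum[OF assms(2)] by linarith
qed

lemma abs_t_less: "\<bar>t x j\<bar> < 1"
  using tanh_real_bounds[of "\<beta> * m x j + B"] by (simp add: t_def abs_less_iff)

lemma residual_bound:
  assumes "x \<in> configs n" "j < n"
  shows "\<bar>x j - t x j\<bar> \<le> 2"
  using abs_config[OF assms] abs_t_less[of x j] by linarith

lemma local_field_flip:
  assumes "j < n"
  shows "m (flip j x) k = m x k - 2 * A n k j * x j"
proof -
  have "m (flip j x) k = (\<Sum>i<n. A n k i * x i - (if i = j then 2 * A n k j * x j else 0))"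
    unfolding local_field_def by (intro sum.cong) (auto simp: flip_def)
  then show ?thesis using assms by (simp add: sum_subtractf local_field_def)
qed

lemma local_field_flip_same: "j < n \<Longrightarrow> m (flip j x) j = m x j"
  by (simp add: local_field_flip diag)

lemma t_flip_diff:
  assumes "x \<in> configs n" "j < n" "k < n"
  shows "\<bar>t x k - t (flip j x) k\<bar> \<le> 2 * \<bar>\<beta>\<bar> * A n k j"
proof -
  have "\<bar>t x k - t (flip j x) k\<bar> \<le> \<bar>(\<beta> * m x k + B) - (\<beta> * m (flip j x) k + B)\<bar>"
    unfolding t_def by (rule tanh_lipschitz)
  also have "\<dots> = \<bar>\<beta> * (2 * A n k j * x j)\<bar>"
    by (simp add: local_field_flip[OF assms(2)] algebra_simps)
  also have "\<dots> = 2 * \<bar>\<beta>\<bar> * A n k j"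
    using abs_config[OF assms(1,2)] nonneg[OF assms(3,2)] by (simp add: abs_mult)
  finally show ?thesis .
qed

text \<open>By symmetry the row and the column of \<open>j\<close> contribute equally, and the zero
  diagonal makes \<open>m x j\<close> independent of \<open>x j\<close>. All dependence on spin
  \<open>j\<close> therefore sits in the first summand, where it is linear.\<close>

lemma energy_split:
  assumes "j < n"
  defines "I \<equiv> {..<n} - {j}"
  shows "(\<Sum>i<n. \<Sum>k<n. x i * A n i k * x k) = 2 * x j * m x j + (\<Sum>i\<in>I. \<Sum>k\<in>I. x i * A n i k * x k)"
proof -
  have split: "(\<Sum>i<n. f i) = f j + (\<Sum>i\<in>I. f i)" for f :: "nat \<Rightarrow> real"
    unfolding I_def using assms(1) by (intro sum.remove) auto
  have "(\<Sum>i\<in>I. x i * A n i j * x j) = x j * (\<Sum>i\<in>I. A n j i * x i)"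
    unfolding sum_distrib_left by (intro sum.cong) (auto simp: I_def symm[OF _ assms(1)])
  also have "(\<Sum>i\<in>I. A n j i * x i) = m x j"
    using split[of "\<lambda>i. A n j i * x i"] diag[OF assms(1)] by (simp add: local_field_def)
  finally have "(\<Sum>i\<in>I. x i * A n i j * x j) = x j * m x j" .
  moreover have "(\<Sum>k<n. x j * A n j k * x k) = x j * m x j"
    by (simp add: local_field_def sum_distrib_left mult.assoc)
  moreover have "(\<Sum>i<n. \<Sum>k<n. x i * A n i k * x k) = (\<Sum>k<n. x j * A n j k * x k)
      + (\<Sum>i\<in>I. x i * A n i j * x j + (\<Sum>k\<in>I. x i * A n i k * x k))"
    by (subst split, subst (2) split) simp
  ultimately show ?thesis by (simp add: sum.distrib)
qed

text \<open>By \<open>energy_split\<close>, the flip only reverses the sign of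
  \<open>x j * (\<beta> * m x j + B)\<close> in the exponent.\<close>

lemma weight_flip:
  assumes "j < n"
  shows "ising_weight A n \<beta> B (flip j x)
    = exp (- 2 * x j * (\<beta> * m x j + B)) * ising_weight A n \<beta> B x"
proof -
  let ?I = "{..<n} - {j}"
  have split: "(\<Sum>i<n. f i) = f j + (\<Sum>i\<in>?I. f i)" for f :: "nat \<Rightarrow> real"
    using assms(1) by (intro sum.remove) auto
  have "(\<Sum>i\<in>?I. \<Sum>k\<in>?I. flip j x i * A n i k * flip j x k) = (\<Sum>i\<in>?I. \<Sum>k\<in>?I. x i * A n i k * x k)"
    by (intro sum.cong) auto
  moreover have "(\<Sum>i\<in>?I. flip j x i) = (\<Sum>i\<in>?I. x i)" by (intro sum.cong) auto
  ultimately show ?thesis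
    unfolding ising_weight_def energy_split[OF assms] split[of "flip j x"] split[of x]
      exp_add[symmetric] local_field_flip_same[OF assms]
    by (simp add: algebra_simps)
qed

text \<open>\<^term>\<open>t x j\<close> is the conditional mean of \<open>x j\<close> given the other coordinates, so the residual is
  orthogonal to every function of those coordinates.\<close>
lemma expect_residual_eq_0:
  assumes "j < n" and inv: "\<And>x. x \<in> configs n \<Longrightarrow> g (flip j x) = g x"
  shows "expect (\<lambda>x. (x j - t x j) * g x) = 0"
proof -
  define F where "F x = ising_weight A n \<beta> B x * ((x j - t x j) * g x)" for x
  \<comment> \<open>A configuration is paired with its flip; their weights have the ratio in
    \<open>weight_flip\<close>, so \<open>tilt_balance\<close> cancels the two
    contributions.\<close>
  have "F x + F (flip j x) = 0" if "x \<in> configs n" for x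
  proof -
    have "F x + F (flip j x) = ising_weight A n \<beta> B x * g x *
        ((x j - t x j) + exp (- 2 * x j * (\<beta> * m x j + B)) * (- x j - t x j))"
      using that assms
      by (simp add: F_def t_def local_field_flip_same weight_flip algebra_simps)
    then show ?thesis
      using tilt_balance[of "x j" "\<beta> * m x j + B"] config_values[OF that assms(1)] by (simp add: t_def)
  qed
  then have "(\<Sum>x\<in>configs n. F x + F (flip j x)) = 0" by simp
  then have "(\<Sum>x\<in>configs n. F x) = 0"
    using sum_flip[OF assms(1), of F] by (simp add: sum.distrib)
  then show ?thesis by (simp add: expect_def F_def)
qed

text \<open>Only the part of \<open>V\<close> that is odd under flipping the \<open>j\<close>-th spin correlates with the \<open>j\<close>-th
  summand.\<close>
lemma second_moment_bounded_differences:
  fixes h :: "nat \<Rightarrow> (nat \<Rightarrow> real) \<Rightarrow> real" and K C :: real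
  defines "V \<equiv> \<lambda>x. \<Sum>j<n. h j x * (x j - t x j)"
  assumes inv: "\<And>j x. j < n \<Longrightarrow> x \<in> configs n \<Longrightarrow> h j (flip j x) = h j x"
    and bound: "\<And>j x. j < n \<Longrightarrow> x \<in> configs n \<Longrightarrow> \<bar>h j x\<bar> \<le> K"
    and diff: "\<And>j x. j < n \<Longrightarrow> x \<in> configs n \<Longrightarrow> \<bar>V x - V (flip j x)\<bar> \<le> C"
  shows "expect (\<lambda>x. (V x)\<^sup>2) \<le> n * (K * C)"
proof -
  have summand: "expect (\<lambda>x. h j x * (x j - t x j) * V x) \<le> K * C" if "j < n" for j
  proof -
    let ?e = "\<lambda>x. (x j - t x j) * (h j x * ((V x + V (flip j x)) / 2))"
    let ?o = "\<lambda>x. h j x * (x j - t x j) * ((V x - V (flip j x)) / 2)"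
    have "expect (\<lambda>x. h j x * (x j - t x j) * V x) = expect (\<lambda>x. ?e x + ?o x)"
      by (intro expect_cong) (simp add: field_simps)
    also have "\<dots> = expect ?e + expect ?o" by (rule expect_add)
    finally have split: "expect (\<lambda>x. h j x * (x j - t x j) * V x) = expect ?e + expect ?o" .
    have even: "expect ?e = 0"
      by (rule expect_residual_eq_0[OF that]) (simp add: inv[OF that] add.commute)
    have "expect ?o \<le> expect (\<lambda>_. K * C)"
    proof (rule expect_mono)
      fix x assume x: "x \<in> configs n"
      have "?o x \<le> \<bar>h j x\<bar> * \<bar>x j - t x j\<bar> * (\<bar>V x - V (flip j x)\<bar> / 2)"
        using abs_ge_self[of "?o x"] unfolding abs_mult abs_divide by simp
      also have "\<dots> \<le> K * 2 * (C / 2)"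
        using bound[OF that x] residual_bound[OF x that] diff[OF that x]
        by (intro mult_mono divide_right_mono) auto
      finally show "?o x \<le> K * C" by simp
    qed
    then show ?thesis unfolding split even expect_const by simp
  qed
  have "expect (\<lambda>x. (V x)\<^sup>2) = expect (\<lambda>x. \<Sum>j<n. h j x * (x j - t x j) * V x)"
    by (simp add: V_def power2_eq_square sum_distrib_right)
  also have "\<dots> = (\<Sum>j<n. expect (\<lambda>x. h j x * (x j - t x j) * V x))" by (rule expect_sum)
  also have "\<dots> \<le> (\<Sum>j<n. K * C)" using summand by (intro sum_mono) auto
  finally show ?thesis by simp
qed

text \<open>A discrete product rule: flipping spin \<open>j\<close> changes the coefficients, each
  multiplied by a residual of size at most 2, and the residuals, each multiplied by at most
  \<open>K\<close>. The residuals change by 2 through the spin itself and by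
  \<open>2 * \<bar>\<beta>\<bar> * A n k j\<close> through each \<open>t x k\<close>, which column
  sums control.\<close>

lemma second_moment_linear:
  fixes h :: "nat \<Rightarrow> (nat \<Rightarrow> real) \<Rightarrow> real" and K H :: real
  assumes inv: "\<And>j x. j < n \<Longrightarrow> x \<in> configs n \<Longrightarrow> h j (flip j x) = h j x"
    and bound: "\<And>j x. j < n \<Longrightarrow> x \<in> configs n \<Longrightarrow> \<bar>h j x\<bar> \<le> K"
    and diff: "\<And>j x. j < n \<Longrightarrow> x \<in> configs n \<Longrightarrow> (\<Sum>k<n. \<bar>h k x - h k (flip j x)\<bar>) \<le> H"
  shows "expect (\<lambda>x. (\<Sum>j<n. h j x * (x j - t x j))\<^sup>2) \<le> n * (K * (2 * H + K * (2 + 2 * \<bar>\<beta>\<bar> * \<gamma>)))"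
proof (rule second_moment_bounded_differences[where h = h, OF inv bound])
  fix j x assume j: "j < n" and x: "x \<in> configs n"
  let ?x = "flip j x"
  have K: "K \<ge> 0" using bound[OF j x] by linarith
  have "\<bar>(\<Sum>k<n. h k x * (x k - t x k)) - (\<Sum>k<n. h k ?x * (?x k - t ?x k))\<bar>
      \<le> (\<Sum>k<n. \<bar>h k x * (x k - t x k) - h k ?x * (?x k - t ?x k)\<bar>)"
    unfolding sum_subtractf[symmetric] by (rule sum_abs)
  also have "\<dots> \<le> (\<Sum>k<n. 2 * \<bar>h k x - h k ?x\<bar> + K * ((if k = j then 2 else 0) + 2 * \<bar>\<beta>\<bar> * A n k j))"
  proof (rule sum_mono)
    fix k assume "k \<in> {..<n}"
    then have k: "k < n" by simp
    have "\<bar>x k - ?x k\<bar> \<le> (if k = j then 2 else 0)"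
      using abs_config[OF x k] by auto
    then have "\<bar>(x k - t x k) - (?x k - t ?x k)\<bar> \<le> (if k = j then 2 else 0) + 2 * \<bar>\<beta>\<bar> * A n k j"
      using t_flip_diff[OF x j k] by linarith
    then have "\<bar>h k ?x * ((x k - t x k) - (?x k - t ?x k))\<bar>
        \<le> K * ((if k = j then 2 else 0) + 2 * \<bar>\<beta>\<bar> * A n k j)"
      unfolding abs_mult using bound[OF k flip_configs[OF x j]] K by (intro mult_mono) auto
    moreover have "\<bar>(h k x - h k ?x) * (x k - t x k)\<bar> \<le> 2 * \<bar>h k x - h k ?x\<bar>"
      unfolding abs_mult 
      using mult_left_mono[OF residual_bound[OF x k], of "\<bar>h k x - h k ?x\<bar>"] by (simp add: mult.commute)
    moreover have "h k x * (x k - t x k) - h k ?x * (?x k - t ?x k)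
        = (h k x - h k ?x) * (x k - t x k) + h k ?x * ((x k - t x k) - (?x k - t ?x k))"
      by (simp add: algebra_simps)
    ultimately show "\<bar>h k x * (x k - t x k) - h k ?x * (?x k - t ?x k)\<bar>
        \<le> 2 * \<bar>h k x - h k ?x\<bar> + K * ((if k = j then 2 else 0) + 2 * \<bar>\<beta>\<bar> * A n k j)"
      by linarith
  qed
  also have "\<dots> = 2 * (\<Sum>k<n. \<bar>h k x - h k ?x\<bar>) + K * (2 + 2 * \<bar>\<beta>\<bar> * (\<Sum>k<n. A n k j))"
    using j by (simp add: sum.distrib sum_distrib_left[symmetric])
  also have "\<dots> \<le> 2 * H + K * (2 + 2 * \<bar>\<beta>\<bar> * \<gamma>)"
    using diff[OF j x] col_sum[OF j] K by (intro add_mono mult_left_mono) auto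
  finally show "\<bar>(\<Sum>k<n. h k x * (x k - t x k)) - (\<Sum>k<n. h k ?x * (?x k - t ?x k))\<bar>
      \<le> 2 * H + K * (2 + 2 * \<bar>\<beta>\<bar> * \<gamma>)" .
qed

text \<open>The scale \<open>sqrt n\<close> matches a second moment of order \<open>n\<close>, so
  the tail bound is free of \<open>n\<close>.\<close>

lemma chebyshev:
  fixes C K :: real
  assumes "expect (\<lambda>x. (V x)\<^sup>2) \<le> n * C" "n > 0" "K > 0"
  shows "expect (\<lambda>x. of_bool (\<bar>V x\<bar> > K * sqrt n)) \<le> C / K\<^sup>2"
proof -
  have "expect (\<lambda>x. of_bool (\<bar>V x\<bar> > K * sqrt n)) \<le> expect (\<lambda>x. 1 / (n * K\<^sup>2) * (V x)\<^sup>2)"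
  proof (rule expect_mono)
    fix x
    show "of_bool (\<bar>V x\<bar> > K * sqrt n) \<le> 1 / (n * K\<^sup>2) * (V x)\<^sup>2"
    proof (cases "\<bar>V x\<bar> > K * sqrt n")
      case True
      then have "(K * sqrt n)\<^sup>2 \<le> (V x)\<^sup>2" using \<open>K > 0\<close> by (intro abs_le_square_iff[THEN iffD1]) simp
      then have "n * K\<^sup>2 \<le> (V x)\<^sup>2" by (simp add: power_mult_distrib mult.commute)
      then show ?thesis using assms(2,3) by (simp add: True)
    qed simp
  qed
  also have "\<dots> = 1 / (n * K\<^sup>2) * expect (\<lambda>x. (V x)\<^sup>2)" by (rule expect_cmult)
  also have "\<dots> \<le> 1 / (n * K\<^sup>2) * (n * C)" using assms(1) by (intro mult_left_mono) auto
  finally show ?thesis using assms(2) by simp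
qed

section \<open>Four centred sums and their second moments\<close>

definition V_field :: "(nat \<Rightarrow> real) \<Rightarrow> real" where
  "V_field x = (\<Sum>j<n. m x j * (x j - t x j))"

definition V_spin :: "(nat \<Rightarrow> real) \<Rightarrow> real" where
  "V_spin x = (\<Sum>j<n. 1 * (x j - t x j))"

text \<open>The sum over \<open>i\<close> of the responses
  \<open>\<Sum>j<n. A n i j * (x j - t x j)\<close>, rearranged so that each residual has a constant
  coefficient.\<close>

definition V_degree :: "(nat \<Rightarrow> real) \<Rightarrow> real" where
  "V_degree x = (\<Sum>j<n. (\<Sum>i<n. A n i j) * (x j - t x j))"

text \<open>The term \<open>A n i j * x j\<close> is removed from \<open>m x i\<close> so that the coefficient of the \<open>j\<close>-th
  residual does not depend on \<open>x j\<close>.\<close>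
definition V_quad :: "(nat \<Rightarrow> real) \<Rightarrow> real" where
  "V_quad x = (\<Sum>j<n. (\<Sum>i<n. A n i j * (m x i - A n i j * x j)) * (x j - t x j))"

text \<open>Bounds the total change of all residuals under one flip.\<close>

abbreviation L :: real where "L \<equiv> 2 + 2 * \<bar>\<beta>\<bar> * \<gamma>"

text \<open>The four second-moment constants, for spin, field, degree and quad in this order, added
  up for the union bound.\<close>

definition moment_const :: real where
  "moment_const = L + \<gamma> * (4 * \<gamma> + \<gamma> * L) + \<gamma> * (\<gamma> * L) + 2 * \<gamma>\<^sup>2 * (8 * \<gamma>\<^sup>2 + 2 * \<gamma>\<^sup>2 * L)"

lemma sum_field_flip_diff:
  assumes "x \<in> configs n" "j < n"
  shows "(\<Sum>k<n. a k * \<bar>m x k - m (flip j x) k\<bar>) = (\<Sum>k<n. a k * (2 * A n k j))"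
  using assms abs_config nonneg by (intro sum.cong) (auto simp: local_field_flip abs_mult)

lemma second_moment_spin: "expect (\<lambda>x. (V_spin x)\<^sup>2) \<le> n * L"
  using second_moment_linear[of "\<lambda>_ _. 1" 1 0] by (simp add: V_spin_def)

text \<open>The coefficient \<open>m x j\<close> ignores \<open>x j\<close> because the diagonal
  vanishes, and one flip moves the local fields by at most twice a column sum in total.\<close>

lemma second_moment_field: "expect (\<lambda>x. (V_field x)\<^sup>2) \<le> n * (\<gamma> * (4 * \<gamma> + \<gamma> * L))"
proof -
  have "expect (\<lambda>x. (V_field x)\<^sup>2) \<le> n * (\<gamma> * (2 * (2 * \<gamma>) + \<gamma> * L))"
    unfolding V_field_def
  proof (rule second_moment_linear)
    fix j x assume "j < n" and x: "x \<in> configs n"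
    show "(\<Sum>k<n. \<bar>m x k - m (flip j x) k\<bar>) \<le> 2 * \<gamma>"
      using sum_field_flip_diff[OF x \<open>j < n\<close>, of "\<lambda>_. 1"] col_sum[OF \<open>j < n\<close>]
      by (simp add: sum_distrib_left[symmetric])
  qed (simp_all add: local_field_flip_same local_field_bound)
  then show ?thesis by simp
qed

lemma col_sum_nonneg: "j < n \<Longrightarrow> 0 \<le> (\<Sum>i<n. A n i j)"
  by (intro sum_nonneg) (simp add: nonneg)

lemma second_moment_degree: "expect (\<lambda>x. (V_degree x)\<^sup>2) \<le> n * (\<gamma> * (\<gamma> * L))"
proof -
  have "expect (\<lambda>x. (V_degree x)\<^sup>2) \<le> n * (\<gamma> * (2 * 0 + \<gamma> * L))"
    unfolding V_degree_def
    by (rule second_moment_linear) (simp_all add: col_sum col_sum_nonneg)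
  then show ?thesis by simp
qed

lemma entry_le: "i < n \<Longrightarrow> j < n \<Longrightarrow> A n i j \<le> \<gamma>"
  using member_le_sum[of j "{..<n}" "A n i"] row_sum[of i] nonneg[of i] by force

text \<open>In the coefficient of the residual at \<open>j\<close>, flipping spin \<open>j\<close>
  moves \<open>m x i\<close> and the subtracted term equally. Each coefficient involves products of
  two matrix entries, so row and column sums together give its size and its total change of order
  \<open>\<gamma>\<^sup>2\<close>.\<close>

lemma second_moment_quad: "expect (\<lambda>x. (V_quad x)\<^sup>2) \<le> n * (2 * \<gamma>\<^sup>2 * (8 * \<gamma>\<^sup>2 + 2 * \<gamma>\<^sup>2 * L))"
proof -
  let ?h = "\<lambda>j x. \<Sum>i<n. A n i j * (m x i - A n i j * x j)"
  have "expect (\<lambda>x. (V_quad x)\<^sup>2) \<le> n * (2 * \<gamma>\<^sup>2 * (2 * (4 * \<gamma>\<^sup>2) + 2 * \<gamma>\<^sup>2 * L))"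
    unfolding V_quad_def
  proof (rule second_moment_linear)
    fix j x assume j: "j < n" and x: "x \<in> configs n"
    show "?h j (flip j x) = ?h j x"
      by (simp add: local_field_flip[OF j] mult.commute)
    have "\<bar>?h j x\<bar> \<le> (\<Sum>i<n. A n i j * (2 * \<gamma>))"
    proof (rule order_trans[OF sum_abs sum_mono])
      fix i assume "i \<in> {..<n}"
      then have i: "i < n" by simp
      have "\<bar>A n i j * x j\<bar> \<le> \<gamma>"
        using entry_le[OF i j] nonneg[OF i j] abs_config[OF x j] by (simp add: abs_mult)
      then have "\<bar>m x i - A n i j * x j\<bar> \<le> 2 * \<gamma>"
        using local_field_bound[OF x i] by linarith
      then show "\<bar>A n i j * (m x i - A n i j * x j)\<bar> \<le> A n i j * (2 * \<gamma>)"
        using nonneg[OF i j] by (simp add: abs_mult mult_left_mono)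
    qed
    also have "\<dots> \<le> \<gamma> * (2 * \<gamma>)"
      unfolding sum_distrib_right[symmetric] using col_sum[OF j] \<gamma>_nonneg by (intro mult_right_mono) auto
    finally show "\<bar>?h j x\<bar> \<le> 2 * \<gamma>\<^sup>2" by (simp add: power2_eq_square)
    let ?x = "flip j x"
    have "(\<Sum>k<n. \<bar>?h k x - ?h k ?x\<bar>)
        \<le> (\<Sum>k<n. \<Sum>i<n. A n i k * (2 * A n i j) + (if k = j then A n i j * (2 * \<gamma>) else 0))"
    proof (rule sum_mono)
      fix k assume "k \<in> {..<n}"
      then have k: "k < n" by simp
      show "\<bar>?h k x - ?h k ?x\<bar> \<le> (\<Sum>i<n. A n i k * (2 * A n i j) + (if k = j then A n i j * (2 * \<gamma>) else 0))"
        unfolding sum_subtractf[symmetric]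
      proof (rule order_trans[OF sum_abs sum_mono])
        fix i assume "i \<in> {..<n}"
        then have i: "i < n" by simp
        have 1: "\<bar>m x i - m ?x i\<bar> = 2 * A n i j"
          using abs_config[OF x j] nonneg[OF i j] by (simp add: local_field_flip[OF j] abs_mult)
        have 2: "\<bar>A n i k * (x k - ?x k)\<bar> \<le> (if k = j then 2 * \<gamma> else 0)"
          using abs_config[OF x j] nonneg[OF i j] entry_le[OF i j] by (auto simp: abs_mult)
        have "\<bar>(m x i - A n i k * x k) - (m ?x i - A n i k * ?x k)\<bar>
            \<le> \<bar>m x i - m ?x i\<bar> + \<bar>A n i k * (x k - ?x k)\<bar>"
          unfolding right_diff_distrib by linarith
        then have "\<bar>(m x i - A n i k * x k) - (m ?x i - A n i k * ?x k)\<bar>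
            \<le> 2 * A n i j + (if k = j then 2 * \<gamma> else 0)"
          using 1 2 by linarith
        then have "A n i k * \<bar>(m x i - A n i k * x k) - (m ?x i - A n i k * ?x k)\<bar>
            \<le> A n i k * (2 * A n i j + (if k = j then 2 * \<gamma> else 0))"
          by (rule mult_left_mono) (rule nonneg[OF i k])
        moreover have "\<bar>A n i k * (m x i - A n i k * x k) - A n i k * (m ?x i - A n i k * ?x k)\<bar>
            = A n i k * \<bar>(m x i - A n i k * x k) - (m ?x i - A n i k * ?x k)\<bar>"
          unfolding right_diff_distrib[symmetric] abs_mult using nonneg[OF i k] by simp
        ultimately show "\<bar>A n i k * (m x i - A n i k * x k) - A n i k * (m ?x i - A n i k * ?x k)\<bar>
            \<le> A n i k * (2 * A n i j) + (if k = j then A n i j * (2 * \<gamma>) else 0)"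
          by (simp add: distrib_left split: if_splits)
      qed
    qed
    \<comment> \<open>Summing over \<open>k\<close> first turns \<open>A n i k\<close> into a row
      sum; the case \<open>k = j\<close> adds one more \<open>\<gamma>\<close>.\<close>
    also have "\<dots> = (\<Sum>i<n. \<Sum>k<n. A n i k * (2 * A n i j) + (if k = j then A n i j * (2 * \<gamma>) else 0))"
      by (rule sum.swap)
    also have "\<dots> = (\<Sum>i<n. ((\<Sum>k<n. A n i k) + \<gamma>) * (2 * A n i j))"
    proof (intro sum.cong refl)
      fix i
      have "(\<Sum>k<n. A n i k * (2 * A n i j)) = (\<Sum>k<n. A n i k) * (2 * A n i j)"
        by (rule sum_distrib_right[symmetric])
      then show "(\<Sum>k<n. A n i k * (2 * A n i j) + (if k = j then A n i j * (2 * \<gamma>) else 0))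
          = ((\<Sum>k<n. A n i k) + \<gamma>) * (2 * A n i j)"
        using j by (simp only: sum.distrib) (simp add: algebra_simps)
    qed
    also have "\<dots> \<le> (\<Sum>i<n. (\<gamma> + \<gamma>) * (2 * A n i j))"
      using row_sum nonneg j by (intro sum_mono mult_right_mono add_right_mono) auto
    also have "\<dots> = 4 * \<gamma> * (\<Sum>i<n. A n i j)" by (simp add: sum_distrib_left algebra_simps)
    also have "\<dots> \<le> 4 * \<gamma> * \<gamma>" using col_sum[OF j] \<gamma>_nonneg by (intro mult_left_mono) auto
    finally show "(\<Sum>k<n. \<bar>?h k x - ?h k ?x\<bar>) \<le> 4 * \<gamma>\<^sup>2" by (simp add: power2_eq_square)
  qed
  then show ?thesis by simp
qed

section \<open>The event of high probability and its consequences\<close>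

definition good :: "real \<Rightarrow> (nat \<Rightarrow> real) \<Rightarrow> bool" where
  "good K x \<longleftrightarrow> \<bar>V_spin x\<bar> \<le> K * sqrt n \<and> \<bar>V_field x\<bar> \<le> K * sqrt n \<and>
     \<bar>V_degree x\<bar> \<le> K * sqrt n \<and> \<bar>V_quad x\<bar> \<le> K * sqrt n"

text \<open>Union bound over the four sums, each controlled by \<open>chebyshev\<close>.\<close>

lemma expect_good:
  assumes "n > 0" "K > 0"
  shows "expect (\<lambda>x. of_bool (good K x)) \<ge> 1 - moment_const / K\<^sup>2"
proof -
  let ?b = "\<lambda>V x. of_bool (\<bar>V x\<bar> > K * sqrt n) :: real"
  have "1 = expect (\<lambda>_. 1)" by (simp add: expect_const)
  also have "\<dots> \<le> expect (\<lambda>x. of_bool (good K x) + (?b V_spin x + (?b V_field x + (?b V_degree x + ?b V_quad x))))"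
    by (intro expect_mono) (auto simp: good_def)
  also have "\<dots> = expect (\<lambda>x. of_bool (good K x))
      + (expect (?b V_spin) + (expect (?b V_field) + (expect (?b V_degree) + expect (?b V_quad))))"
    by (simp only: expect_add)
  finally show ?thesis
    using chebyshev[OF second_moment_spin assms] chebyshev[OF second_moment_field assms]
      chebyshev[OF second_moment_degree assms] chebyshev[OF second_moment_quad assms]
    unfolding moment_const_def add_divide_distrib by linarith
qed

lemma pl_score_true: "pl_score A n x (\<beta>, B) = (V_field x, V_spin x)"
  by (simp add: pl_score_def V_field_def V_spin_def t_def)

lemma sum_response: "(\<Sum>i<n. \<Sum>j<n. A n i j * (x j - t x j)) = V_degree x"
  unfolding V_degree_def sum_distrib_right by (rule sum.swap)

text \<open>The terms \<open>(A n i j)\<^sup>2 * x j * (x j - t x j)\<close> missing from \<^term>\<open>V_quad\<close> have a positive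
  lower bound because \<open>x j * x j = 1\<close>: this is where the sparseness condition enters.\<close>
lemma field_response_lower:
  assumes "x \<in> configs n"
  shows "V_quad x + (1 - tanh (\<bar>\<beta>\<bar> * \<gamma> + \<bar>B\<bar>)) * (\<Sum>i<n. \<Sum>j<n. (A n i j)\<^sup>2)
    \<le> (\<Sum>i<n. m x i * (\<Sum>j<n. A n i j * (x j - t x j)))"
proof -
  let ?\<tau> = "1 - tanh (\<bar>\<beta>\<bar> * \<gamma> + \<bar>B\<bar>)"
  have "V_quad x = (\<Sum>j<n. \<Sum>i<n. A n i j * (m x i - A n i j * x j) * (x j - t x j))"
    by (simp add: V_quad_def sum_distrib_right)
  also have "\<dots> = (\<Sum>i<n. \<Sum>j<n. A n i j * (m x i - A n i j * x j) * (x j - t x j))"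
    by (rule sum.swap)
  finally have "V_quad x + ?\<tau> * (\<Sum>i<n. \<Sum>j<n. (A n i j)\<^sup>2)
    = (\<Sum>i<n. \<Sum>j<n. A n i j * (m x i - A n i j * x j) * (x j - t x j) + ?\<tau> * (A n i j)\<^sup>2)"
    by (simp add: sum.distrib sum_distrib_left)
  also have "\<dots> \<le> (\<Sum>i<n. \<Sum>j<n. m x i * (A n i j * (x j - t x j)))"
  proof (intro sum_mono)
    fix i j assume "i \<in> {..<n}" "j \<in> {..<n}"
    then have j: "j < n" by simp
    have "\<bar>\<beta> * m x j + B\<bar> \<le> \<bar>\<beta>\<bar> * \<gamma> + \<bar>B\<bar>"
      using mult_left_mono[OF local_field_bound[OF assms j], of "\<bar>\<beta>\<bar>"]
        abs_triangle_ineq[of "\<beta> * m x j" B] by (simp add: abs_mult)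
    then have "tanh \<bar>\<beta> * m x j + B\<bar> \<le> tanh (\<bar>\<beta>\<bar> * \<gamma> + \<bar>B\<bar>)"
      unfolding tanh_real_le_iff .
    then have "\<bar>t x j\<bar> \<le> tanh (\<bar>\<beta>\<bar> * \<gamma> + \<bar>B\<bar>)" by (simp add: t_def)
    \<comment> \<open>Since \<open>x j * x j = 1\<close>, the right-hand side is
      \<open>1 - x j * t x j\<close>, which is at least
      \<open>1 - \<bar>t x j\<bar>\<close>.\<close>
    then have "?\<tau> \<le> x j * (x j - t x j)"
      using config_values[OF assms j] by auto
    then have "(A n i j)\<^sup>2 * ?\<tau> \<le> (A n i j)\<^sup>2 * (x j * (x j - t x j))"
      by (intro mult_left_mono) auto
    then show "A n i j * (m x i - A n i j * x j) * (x j - t x j) + ?\<tau> * (A n i j)\<^sup>2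
        \<le> m x i * (A n i j * (x j - t x j))"
      by (simp add: power2_eq_square algebra_simps)
  qed
  also have "\<dots> = (\<Sum>i<n. m x i * (\<Sum>j<n. A n i j * (x j - t x j)))"
    by (simp add: sum_distrib_left)
  finally show ?thesis .
qed

lemma response_bound:
  assumes "x \<in> configs n" "i < n"
  shows "\<bar>\<Sum>j<n. A n i j * (x j - t x j)\<bar> \<le> 2 * \<gamma>"
proof -
  have "\<bar>\<Sum>j<n. A n i j * (x j - t x j)\<bar> \<le> (\<Sum>j<n. A n i j * 2)"
  proof (rule order_trans[OF sum_abs sum_mono])
    fix j assume "j \<in> {..<n}"
    then show "\<bar>A n i j * (x j - t x j)\<bar> \<le> A n i j * 2"
      using nonneg[of i j] assms residual_bound[of x j] by (simp add: abs_mult mult_left_mono)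
  qed
  then show ?thesis using row_sum[OF assms(2)] by (simp add: sum_distrib_right[symmetric])
qed

text \<open>On the good event \<open>V_quad\<close> and \<open>V_degree\<close> are of order
  \<open>sqrt n\<close>, hence negligible against \<open>n\<close>, so the responses satisfy the
  hypotheses of \<open>design_bound\<close>; \<open>V_field\<close> and \<open>V_spin\<close> bound
  the score. Then \<open>pl_est_close\<close> applies.\<close>

lemma good_imp_pl_est_close:
  fixes K c :: real
  defines "\<mu> \<equiv> 4 * \<gamma> / c + 1 / \<gamma>"
  defines "M \<equiv> 4 * K * (\<mu>\<^sup>2 + (1 + \<mu> * \<gamma>)\<^sup>2) / (1 - tanh (\<bar>\<beta>\<bar> * \<gamma> + \<bar>B\<bar> + \<gamma> + 1) ^ 2)"
  assumes "n > 0" "\<gamma> > 0" "c > 0" "K > 0"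
    and sparse: "2 * c * n \<le> (1 - tanh (\<bar>\<beta>\<bar> * \<gamma> + \<bar>B\<bar>)) * (\<Sum>i<n. \<Sum>j<n. (A n i j)\<^sup>2)"
    and large: "K \<le> c * sqrt n" "K \<le> c / (2 * \<gamma>) * sqrt n" "M \<le> sqrt n"
    and x: "x \<in> configs n" and good: "good K x"
  shows "pl_exists A n x \<and> sqrt n * \<bar>fst (pl_est A n x) - \<beta>\<bar> \<le> M \<and> sqrt n * \<bar>snd (pl_est A n x) - B\<bar> \<le> M"
proof -
  have sq: "sqrt n * sqrt n = real n" by simp
  have K1: "K * sqrt n \<le> c * n"
    using mult_right_mono[OF large(1), of "sqrt n"] by (simp add: mult.assoc sq)
  have K2: "K * sqrt n \<le> c / (2 * \<gamma>) * n"
    using mult_right_mono[OF large(2), of "sqrt n"] by (simp only: mult.assoc sq) simp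
  let ?v = "\<lambda>i. \<Sum>j<n. A n i j * (x j - t x j)"
  \<comment> \<open>The factor 2 in \<open>sparse\<close> leaves \<open>c * n\<close> after
    subtracting \<open>K * sqrt n\<close>, the largest possible loss from
    \<open>V_quad\<close>.\<close>
  have Z: "c * n \<le> (\<Sum>i<n. m x i * ?v i)"
    using field_response_lower[OF x] sparse K1 good unfolding good_def by linarith
  have D: "\<bar>\<Sum>i<n. ?v i\<bar> \<le> c / (2 * \<gamma>) * n"
    using good K2 unfolding sum_response good_def by linarith
  have "\<mu> > 0" using \<open>\<gamma> > 0\<close> \<open>c > 0\<close> by (simp add: \<mu>_def add_pos_pos)
  show ?thesis
    unfolding M_def
  proof (rule pl_est_close[OF \<open>n > 0\<close> \<gamma>_nonneg _ \<open>K > 0\<close> local_field_bound[OF x]])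
    show "0 < \<mu>\<^sup>2 + (1 + \<mu> * \<gamma>)\<^sup>2" using \<open>\<mu> > 0\<close> by (simp add: add_pos_nonneg)
    show "n * (a\<^sup>2 + b\<^sup>2) \<le> (\<mu>\<^sup>2 + (1 + \<mu> * \<gamma>)\<^sup>2) * (\<Sum>i<n. (a * m x i + b)\<^sup>2)" for a b :: real
      unfolding \<mu>_def
      by (rule design_bound[OF \<open>n > 0\<close> \<open>\<gamma> > 0\<close> \<open>c > 0\<close> local_field_bound[OF x] response_bound[OF x] Z D])
    show "\<bar>fst (pl_score A n x (\<beta>, B))\<bar> \<le> K * sqrt n" "\<bar>snd (pl_score A n x (\<beta>, B))\<bar> \<le> K * sqrt n"
      using good by (simp_all add: pl_score_true good_def)
    show "4 * K * (\<mu>\<^sup>2 + (1 + \<mu> * \<gamma>)\<^sup>2) / (1 - tanh (\<bar>\<beta>\<bar> * \<gamma> + \<bar>B\<bar> + \<gamma> + 1) ^ 2) \<le> sqrt n"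
      using large(3) unfolding M_def .
  qed
qed

lemma ising_prob_mono:
  "(\<And>x. x \<in> configs n \<Longrightarrow> P x \<Longrightarrow> Q x) \<Longrightarrow> ising_prob A n \<beta> B P \<le> ising_prob A n \<beta> B Q"
  unfolding ising_prob_eq_expect by (rule expect_mono) auto

lemma ising_prob_le_1: "ising_prob A n \<beta> B P \<le> 1"
  using expect_mono[of "\<lambda>x. of_bool (P x)" "\<lambda>_. 1"] by (simp add: ising_prob_eq_expect expect_const)

end

section \<open>Asymptotics for growing size\<close>

theorem theorem5:
  fixes A :: matseq
  assumes symm: "\<And>n i j. i < n \<Longrightarrow> j < n \<Longrightarrow> A n i j = A n j i"
    and nonneg: "\<And>n i j. i < n \<Longrightarrow> j < n \<Longrightarrow> A n i j \<ge> 0"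
    and diag: "\<And>n i. i < n \<Longrightarrow> A n i i = 0"
    and C1: "\<exists>\<gamma>. \<forall>n i. i < n \<longrightarrow> (\<Sum>j<n. A n i j) \<le> \<gamma>"
    and sparse: "liminf (\<lambda>n. ereal ((1 / real n) * (\<Sum>i<n. \<Sum>j<n. (A n i j)\<^sup>2))) > 0"
    and \<Theta>: "\<beta>0 > 0" "B0 \<noteq> 0"
  shows "((\<lambda>n. ising_prob A n \<beta>0 B0 (pl_exists A n)) \<longlonglongrightarrow> 1) \<and>
         (\<forall>\<epsilon>>0. \<exists>M N. \<forall>n\<ge>N.
           ising_prob A n \<beta>0 B0 (\<lambda>x. pl_exists A n x \<and>
               sqrt (real n) * \<bar>fst (pl_est A n x) - \<beta>0\<bar> \<le> M \<and>
               sqrt (real n) * \<bar>snd (pl_est A n x) - B0\<bar> \<le> M) \<ge> 1 - \<epsilon>)"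
proof -
  let ?close = "\<lambda>M n x. pl_exists A n x \<and>
    sqrt (real n) * \<bar>fst (pl_est A n x) - \<beta>0\<bar> \<le> M \<and> sqrt (real n) * \<bar>snd (pl_est A n x) - B0\<bar> \<le> M"
  obtain \<gamma>0 where \<gamma>0: "\<And>n i. i < n \<Longrightarrow> (\<Sum>j<n. A n i j) \<le> \<gamma>0" using C1 by blast
  \<comment> \<open>The maximum with 1 makes the bound positive, as \<open>\<mu>\<close> divides by
    it.\<close>
  define \<gamma> where "\<gamma> = max 1 \<gamma>0"
  have \<gamma>: "\<gamma> > 0" "\<gamma>0 \<le> \<gamma>" by (auto simp: \<gamma>_def)
  have ising: "ising A n \<gamma>" for n
    using symm nonneg diag order_trans[OF \<gamma>0 \<gamma>(2)] \<gamma>(1) by unfold_locales (auto simp: less_imp_le)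
  obtain c0 where c0: "0 < ereal c0" "ereal c0 < liminf (\<lambda>n. ereal ((1 / real n) * (\<Sum>i<n. \<Sum>j<n. (A n i j)\<^sup>2)))"
    using ereal_dense2[OF sparse] by blast
  define \<tau> where "\<tau> = 1 - tanh (\<bar>\<beta>0\<bar> * \<gamma> + \<bar>B0\<bar>)"
  have "\<tau> > 0" using tanh_real_lt_1 by (simp add: \<tau>_def)
  \<comment> \<open>Half of the limiting lower bound, to match the factor 2 in the sparseness
    hypothesis of \<open>good_imp_pl_est_close\<close>.\<close>
  define c where "c = \<tau> * c0 / 2"
  have "c > 0" using \<open>\<tau> > 0\<close> c0(1) by (simp add: c_def)
  have ev_sparse: "\<forall>\<^sub>F n in sequentially. 2 * c * n \<le> \<tau> * (\<Sum>i<n. \<Sum>j<n. (A n i j)\<^sup>2)"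
    using less_LiminfD[OF c0(2)] eventually_gt_at_top[of 0]
  proof eventually_elim
    case (elim n)
    then have "c0 * n \<le> (\<Sum>i<n. \<Sum>j<n. (A n i j)\<^sup>2)" by (simp add: field_simps)
    then have "\<tau> * (c0 * n) \<le> \<tau> * (\<Sum>i<n. \<Sum>j<n. (A n i j)\<^sup>2)"
      using \<open>\<tau> > 0\<close> by (intro mult_left_mono) auto
    then show ?case by (simp add: c_def mult.assoc)
  qed
  have main: "\<exists>M. \<forall>\<^sub>F n in sequentially. ising_prob A n \<beta>0 B0 (?close M n) \<ge> 1 - \<epsilon>" if "\<epsilon> > 0" for \<epsilon> :: real
  proof -
    define C where "C = ising.moment_const \<beta>0 \<gamma>"
    \<comment> \<open>The constant is built from \<open>\<beta>0\<close> and \<open>\<gamma>\<close>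
      alone, so the instance of size 0 serves to unfold it for every size.\<close>
    have "C > 0"
      using \<gamma>(1) unfolding C_def ising.moment_const_def[OF ising[of 0]]
      by (intro add_pos_pos add_pos_nonneg mult_pos_pos) auto
    \<comment> \<open>Gives \<open>K \<ge> 1\<close> and \<open>\<epsilon> * K \<ge> C\<close>, so
      the failure probability \<open>C / K\<^sup>2\<close> is at most
      \<open>\<epsilon>\<close>.\<close>
    define K where "K = C / \<epsilon> + 1"
    have K: "K \<ge> 1" "C / K\<^sup>2 \<le> \<epsilon>"
    proof -
      show "K \<ge> 1" using \<open>C > 0\<close> \<open>\<epsilon> > 0\<close> by (simp add: K_def)
      then have "C \<le> \<epsilon> * K" "K \<le> K\<^sup>2" using \<open>C > 0\<close> \<open>\<epsilon> > 0\<close> by (auto simp: K_def field_simps power2_eq_square)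
      then have "C \<le> \<epsilon> * K\<^sup>2" using \<open>\<epsilon> > 0\<close> by (meson mult_left_mono order_trans less_imp_le)
      then show "C / K\<^sup>2 \<le> \<epsilon>" using \<open>K \<ge> 1\<close> by (simp add: field_simps)
    qed
    define \<mu> where "\<mu> = 4 * \<gamma> / c + 1 / \<gamma>"
    define M where "M = 4 * K * (\<mu>\<^sup>2 + (1 + \<mu> * \<gamma>)\<^sup>2) / (1 - tanh (\<bar>\<beta>0\<bar> * \<gamma> + \<bar>B0\<bar> + \<gamma> + 1) ^ 2)"
    have sqrt_top: "filterlim (\<lambda>n. sqrt (real n)) at_top sequentially"
      by (rule filterlim_compose[OF sqrt_at_top filterlim_real_sequentially])
    then have ev: "\<forall>\<^sub>F n in sequentially. a \<le> sqrt (real n)" for a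
      by (simp add: filterlim_at_top)
    \<comment> \<open>For given \<open>\<epsilon>\<close>, neither \<open>K\<close> nor
      \<open>M\<close> varies with \<open>n\<close>, so the size conditions of
      \<open>good_imp_pl_est_close\<close> hold for all large \<open>n\<close>.\<close>
    have "\<forall>\<^sub>F n in sequentially. ising_prob A n \<beta>0 B0 (?close M n) \<ge> 1 - \<epsilon>"
      using ev_sparse eventually_gt_at_top[of 0] ev[of "K / c"] ev[of "K / (c / (2 * \<gamma>))"] ev[of M]
    proof eventually_elim
      case (elim n)
      interpret ising A n \<beta>0 B0 \<gamma> by (rule ising)
      have "1 - \<epsilon> \<le> expect (\<lambda>x. of_bool (good K x))"
        using expect_good[OF elim(2), of K] K unfolding C_def by simp
      also have "\<dots> = ising_prob A n \<beta>0 B0 (good K)" by (rule ising_prob_eq_expect[symmetric])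
      also have "\<dots> \<le> ising_prob A n \<beta>0 B0 (?close M n)"
      proof (rule ising_prob_mono)
        fix x assume x: "x \<in> configs n" "good K x"
        show "?close M n x"
          unfolding M_def \<mu>_def
        proof (rule good_imp_pl_est_close[OF elim(2) \<gamma>(1) \<open>c > 0\<close> _ _ _ _ _ x])
          show "K > 0" using K by simp
          show "K \<le> c * sqrt n" "K \<le> c / (2 * \<gamma>) * sqrt n"
            using elim(3,4) \<open>c > 0\<close> \<gamma>(1) by (simp_all add: field_simps)
        qed (use elim(1,5) in \<open>simp_all only: \<tau>_def M_def \<mu>_def\<close>)
      qed
      finally show ?case .
    qed
    then show ?thesis by blast
  qed
  have "(\<lambda>n. ising_prob A n \<beta>0 B0 (pl_exists A n)) \<longlonglongrightarrow> 1"
  proof (rule order_tendstoI)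
    fix a :: real assume "a < 1"
    \<comment> \<open>With tolerance \<open>(1 - a) / 2\<close> the probability is at least
      \<open>(1 + a) / 2\<close>, which exceeds \<open>a\<close>.\<close>
    then obtain M where "\<forall>\<^sub>F n in sequentially. ising_prob A n \<beta>0 B0 (?close M n) \<ge> 1 - (1 - a) / 2"
      using main[of "(1 - a) / 2"] by auto
    then show "\<forall>\<^sub>F n in sequentially. a < ising_prob A n \<beta>0 B0 (pl_exists A n)"
    proof eventually_elim
      case (elim n)
      have "ising_prob A n \<beta>0 B0 (?close M n) \<le> ising_prob A n \<beta>0 B0 (pl_exists A n)"
        by (rule ising.ising_prob_mono[OF ising]) auto
      then show ?case using elim \<open>a < 1\<close> by (simp add: field_simps)
    qed
  next
    fix a :: real assume "1 < a"
    then show "\<forall>\<^sub>F n in sequentially. ising_prob A n \<beta>0 B0 (pl_exists A n) < a"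
      using ising.ising_prob_le_1[OF ising] by (intro always_eventually allI) (rule le_less_trans)
  qed
  then show ?thesis using main unfolding eventually_sequentially by blast
qed

end
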